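(* Consider the online learning and prediction problem in an online programming setting (as for instance the one described in the context), with parameter space $\Theta$ as feasible set and stage loss functions $\ell_t:\Theta\to\mathbb R$ $(t\in\mathbb N)$, where $\ell_t(\theta_t)\ge 0$ is the stage prediction error of the prediction model with parameter $\theta_t$, and where the prediction model class is sufficiently expressive to guarantee that $\min_{\theta\in\Theta}\ell_t(\theta)=0$ for all $t\in\mathbb N$ (which is the case e.g. when $\hat{\mathcal F}\supseteq\mathcal F$, i.e. when the hypothesis space $\hat{\mathcal F}$ of predictors contains the class $\mathcal F$ of target functions). If the parameters $\theta_t$ are updated with a no-regret algorithm suitable for the given online programming problem, then the prediction errors vanish with increasing permanence, that is, $\ell_t(\theta_t)\rightsquigarrow 0$ as $t\to\infty$.
   Context: Convergence with increasing permanence (i.p.): a sequence $(s_t)_{t\in\mathbb N}$ in a metric space $(\mathbb S,\mathfrak d)$ converges to $s'\in\mathbb S$ with increasing permanence, written $s_t\rightsquigarrow s'$, iff for all $\epsilon>0$ and all $D,N\in\mathbb N$ there exists $n\in\mathbb N$, $n\ge N$, such that $\mathfrak d(s',s_{n+i})\le\epsilon$ for all $i\in\{1,\dots,D\}$. For real sequences the metric is $|s-s'|$. Online programming: a sequence of loss functions $(\ell_t)_{t\in\mathbb N}$ on a feasible set (here $\Theta$) is revealed step by step. At each time step $t$ the algorithm chooses $\theta_t\in\Theta$ on the basis of its past choices and the feedback received about past loss functions; then information about $\ell_t$ is revealed and the loss $\ell_t(\theta_t)$ is suffered. Online prediction setting: values $y_t=f(x_t)$ of an a priori uncertain target function $f:\mathcal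 X\to\mathcal Y$ in a class $\mathcal F$ are to be predicted by $\hat f(x_t;\theta_t)$, where the hypothesis space $\hat{\mathcal F}$ consists of predictors $\hat f(\cdot;\theta):\mathcal X\to\mathcal Y$ parametrised by $\theta\in\Theta$. Prediction accuracy is measured by a loss $\ell:\mathcal X\times\Theta\to\mathbb R_{\ge0}$ with $\ell(x;\theta)=0$ whenever $f(x)=\hat f(x;\theta)$, and the stage loss function is $\ell_t(\theta)=\ell(x_t;\theta)$. No-regret: the (external) regret is $\mathcal R(T)=\sum_{t=1}^T\ell_t(\theta_t)-\sum_{t=1}^T\ell_t(\theta^*_T)$, where $\theta^*_T\in\operatorname{argmin}_{\theta\in\Theta}\sum_{t=1}^T\ell_t(\theta)$ is the best constant choice in hindsight. An algorithm is no-regret if it guarantees that there is a non-negative function $\Delta$ with $\Delta(T)\in o(T)$ (i.e. $\Delta(T)/T\to0$) and $\mathcal R(T)\le\Delta(T)$.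
   Formalization: Besides each stage loss having minimum 0, it is assumed that for every horizon T one parameter minimises all of the first T losses; otherwise false (losses |θ|, |θ−1| alternating on [0,1], θ_t=1/2). When the hypothesis space contains F, this is proved, not assumed. *)

theory Defs
  imports Complex_Main "HOL-Library.Landau_Symbols"
begin

definition converges_ip :: "(nat \<Rightarrow> 'a::metric_space) \<Rightarrow> 'a \<Rightarrow> bool" where
  "converges_ip s s' \<longleftrightarrow>
     (\<forall>\<epsilon>>0. \<forall>D N. \<exists>n\<ge>N. \<forall>i\<in>{1..D}. dist s' (s (n + i)) \<le> \<epsilon>)"

text \<open>
  Time steps are numbered 1, 2, 3, ...; values at index 0 are never used.
  An environment is a pair of a loss sequence \<open>l\<close>, where \<open>l t p\<close> is the loss of \<open>p\<close> at time \<open>t\<close>,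
  and a feedback map \<open>fb\<close>, where \<open>fb t p\<close> is the information about \<open>l t\<close> revealed after \<open>p\<close> has
  been chosen at time \<open>t\<close> (all of \<open>l t\<close>, a gradient at \<open>p\<close>, the pair of an input and its target
  value, ...). An online programming problem consists of a feasible set and the set of
  environments that may occur.
\<close>

type_synonym 'p losses = "nat \<Rightarrow> 'p \<Rightarrow> real"
type_synonym ('p, 'i) feedback = "nat \<Rightarrow> 'p \<Rightarrow> 'i"
type_synonym ('p, 'i) environment = "'p losses \<times> ('p, 'i) feedback"

text \<open>An algorithm maps the list of past choices and feedbacks (oldest first) to the next choice.\<close>

type_synonym ('p, 'i) algorithm = "('p \<times> 'i) list \<Rightarrow> 'p"

fun history :: "('p, 'i) algorithm \<Rightarrow> ('p, 'i) feedback \<Rightarrow> nat \<Rightarrow> ('p \<times> 'i) list" where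
  "history A fb 0 = []"
| "history A fb (Suc t) =
     history A fb t @ [(A (history A fb t), fb (Suc t) (A (history A fb t)))]"

definition choice :: "('p, 'i) algorithm \<Rightarrow> ('p, 'i) feedback \<Rightarrow> nat \<Rightarrow> 'p" where
  "choice A fb t = A (history A fb (t - 1))"

definition best_in_hindsight :: "'p set \<Rightarrow> 'p losses \<Rightarrow> nat \<Rightarrow> 'p \<Rightarrow> bool" where
  "best_in_hindsight \<Theta> l T p \<longleftrightarrow> is_arg_min (\<lambda>q. \<Sum>t=1..T. l t q) (\<lambda>q. q \<in> \<Theta>) p"

text \<open>
  The comparator \<open>p\<close> is meant to be best in hindsight; the value does not depend on which
  minimiser is taken.
\<close>

definition regret :: "'p losses \<Rightarrow> (nat \<Rightarrow> 'p) \<Rightarrow> 'p \<Rightarrow> nat \<Rightarrow> real" where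
  "regret l \<theta> p T = (\<Sum>t=1..T. l t (\<theta> t)) - (\<Sum>t=1..T. l t p)"

text \<open>
  The bound \<open>\<Delta>\<close> may depend on the environment. This is implied by a bound that is uniform over
  all environments, so an algorithm with a uniform guarantee is no-regret in this sense too.
\<close>

definition no_regret :: "'p set \<Rightarrow> ('p, 'i) environment set \<Rightarrow> ('p, 'i) algorithm \<Rightarrow> bool" where
  "no_regret \<Theta> E A \<longleftrightarrow>
     (\<forall>(l, fb)\<in>E.
        (\<forall>t\<ge>1. choice A fb t \<in> \<Theta>) \<and>
        (\<exists>\<Delta>. (\<forall>T. \<Delta> T \<ge> 0) \<and> \<Delta> \<in> o(\<lambda>T. real T) \<and>
             (\<forall>T\<ge>1. \<forall>p. best_in_hindsight \<Theta> l T p \<longrightarrow> regret l (choice A fb) p T \<le> \<Delta> T)))"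

definition zero_minima :: "'p set \<Rightarrow> 'p losses \<Rightarrow> bool" where
  "zero_minima \<Theta> l \<longleftrightarrow> (\<forall>t\<ge>1. \<exists>p. is_arg_min (l t) (\<lambda>q. q \<in> \<Theta>) p \<and> l t p = 0)"

text \<open>
  A single parameter can attain the minima of all losses up to any given horizon. If, for example,
  losses \<open>\<bar>p\<bar>\<close> and \<open>\<bar>p - 1\<bar>\<close> alternate on the unit interval, then every loss has minimum 0, and the
  constant choice 1/2 has no regret, but all its losses are 1/2. So \<^const>\<open>zero_minima\<close> alone does
  not force the losses of a no-regret algorithm to vanish.
\<close>

definition common_minimisers :: "'p set \<Rightarrow> 'p losses \<Rightarrow> bool" where
  "common_minimisers \<Theta> l \<longleftrightarrow>
     (\<forall>T. \<exists>p. \<forall>t\<in>{1..T}. is_arg_min (l t) (\<lambda>q. q \<in> \<Theta>) p)"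

definition hypothesis_space :: "'p set \<Rightarrow> ('x \<Rightarrow> 'p \<Rightarrow> 'y) \<Rightarrow> ('x \<Rightarrow> 'y) set" where
  "hypothesis_space \<Theta> fhat = (\<lambda>p x. fhat x p) ` \<Theta>"

definition prediction_loss ::
    "'p set \<Rightarrow> ('x \<Rightarrow> 'p \<Rightarrow> 'y) \<Rightarrow> ('x \<Rightarrow> 'y) \<Rightarrow> ('x \<Rightarrow> 'p \<Rightarrow> real) \<Rightarrow> bool" where
  "prediction_loss \<Theta> fhat f L \<longleftrightarrow>
     (\<forall>x. \<forall>p\<in>\<Theta>. L x p \<ge> 0 \<and> (f x = fhat x p \<longrightarrow> L x p = 0))"

end

theory Submission
  imports Defs
begin

text \<open>
  A parameter that minimises the losses up to a horizon \<open>T\<close> simultaneously has total loss 0, so the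
  regret at \<open>T\<close> is the total loss suffered, which is therefore \<open>o(T)\<close>. If the losses did not
  converge to 0 with increasing permanence, then from some time on every window of some fixed
  length \<open>D\<close> would contain a loss above some \<open>\<epsilon> > 0\<close>, and the total loss would grow at least
  linearly, at rate \<open>\<epsilon> / D\<close>.
\<close>

text \<open>The indices after \<open>N\<close> split into consecutive disjoint windows of length
  \<open>D\<close>. Each holds a term of size at least \<open>\<epsilon>\<close>, and nonnegativity
  lets all other terms, including the first \<open>N\<close>, be dropped. The induction appends one
  window at a time.\<close>

lemma sum_windows_ge:
  fixes a :: "nat \<Rightarrow> real"
  assumes nonneg: "\<And>t. t \<ge> 1 \<Longrightarrow> a t \<ge> 0"
    and large: "\<And>n. n \<ge> N \<Longrightarrow> \<exists>i\<in>{1..D}. a (n + i) \<ge> \<epsilon>"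
  shows "real k * \<epsilon> \<le> (\<Sum>t=1..N + k * D. a t)"
proof (induction k)
  case 0
  show ?case using nonneg by (auto intro: sum_nonneg)
next
  case (Suc k)
  let ?n = "N + k * D"
  obtain i where i: "i \<in> {1..D}" "a (?n + i) \<ge> \<epsilon>"
    using large[of ?n] by auto
  have "{1..N + Suc k * D} = {1..?n} \<union> {?n + 1..?n + D}"
    by auto
  then have "(\<Sum>t=1..N + Suc k * D. a t) = (\<Sum>t=1..?n. a t) + (\<Sum>t=?n + 1..?n + D. a t)"
    by (simp add: sum.union_disjoint)
  moreover have "a (?n + i) \<le> (\<Sum>t=?n + 1..?n + D. a t)"
    using i(1) nonneg by (intro member_le_sum) auto
  ultimately show ?case
    using Suc.IH i(2) by (simp add: algebra_simps)
qed

lemma converges_ip_zero_if_sum_le_smallo: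
  fixes a \<Delta> :: "nat \<Rightarrow> real"
  assumes nonneg: "\<And>t. t \<ge> 1 \<Longrightarrow> a t \<ge> 0"
    and bound: "\<And>T. T \<ge> 1 \<Longrightarrow> (\<Sum>t=1..T. a t) \<le> \<Delta> T"
    and smallo: "\<Delta> \<in> o(\<lambda>T. real T)"
  shows "converges_ip a 0"
proof (rule ccontr)
  assume "\<not> converges_ip a 0"
  then obtain \<epsilon> D N where "\<epsilon> > 0"
    and far: "\<And>n. n \<ge> N \<Longrightarrow> \<exists>i\<in>{1..D}. \<not> dist 0 (a (n + i)) \<le> \<epsilon>"
    unfolding converges_ip_def by blast
  have large: "\<exists>i\<in>{1..D}. a (n + i) \<ge> \<epsilon>" if n: "n \<ge> N" for n
  proof -
    obtain i where "i \<in> {1..D}" "\<not> dist 0 (a (n + i)) \<le> \<epsilon>"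
      using far[OF n] by blast
    \<comment> \<open>Since \<open>i\<close> is at least 1, so is the index \<open>n + i\<close>;
      there \<open>a\<close> is nonnegative and equals its distance to 0.\<close>
    then show ?thesis
      using nonneg[of "n + i"] by (intro bexI[of _ i]) (auto simp: dist_real_def)
  qed
  \<comment> \<open>For \<open>D = 0\<close> the window would be empty and could contain no far
    term.\<close>
  have "D \<ge> 1"
    using far[of N] by auto
  \<comment> \<open>Half of the growth rate \<open>\<epsilon> / D\<close> forced by the windows, so
    that the linear lower bound eventually overtakes \<open>\<Delta>\<close>.\<close>
  define c where "c = \<epsilon> / (2 * real D)"
  have "c > 0"
    using \<open>\<epsilon> > 0\<close> \<open>D \<ge> 1\<close> by (simp add: c_def)
  then have "eventually (\<lambda>T. norm (\<Delta> T) \<le> c * norm (real T)) at_top"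
    by (rule landau_o.smallD[OF smallo])
  then obtain M where M: "\<And>T. T \<ge> M \<Longrightarrow> \<bar>\<Delta> T\<bar> \<le> c * real T"
    by (auto simp: eventually_at_top_linorder)
  \<comment> \<open>The summand \<open>M\<close> brings the horizon \<open>N + k * D\<close> into
    the range where \<open>\<Delta>\<close> is small; \<open>k > N\<close> contradicts the final
    inequality.\<close>
  define k where "k = M + N + 1"
  have "k * 1 \<le> k * D"
    using \<open>D \<ge> 1\<close> by (intro mult_left_mono) auto
  then have T: "N + k * D \<ge> M" "N + k * D \<ge> 1"
    by (auto simp: k_def)
  have "real k * \<epsilon> \<le> (\<Sum>t=1..N + k * D. a t)"
    by (intro sum_windows_ge nonneg large)
  also have "\<dots> \<le> \<Delta> (N + k * D)"
    by (rule bound[OF T(2)])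
  also have "\<dots> \<le> c * real (N + k * D)"
    using M[OF T(1)] by linarith
  also have "\<dots> = c * real N + real k * \<epsilon> / 2"
    using \<open>D \<ge> 1\<close> by (simp add: c_def field_simps)
  also have "c * real N \<le> \<epsilon> / 2 * real N"
    using \<open>\<epsilon> > 0\<close> \<open>D \<ge> 1\<close> by (intro mult_right_mono) (auto simp: c_def field_simps)
  finally have "\<epsilon> * real k \<le> \<epsilon> * real N"
    by (simp add: mult.commute)
  then show False
    using \<open>\<epsilon> > 0\<close> by (simp add: k_def)
qed

lemma zero_minima_nonneg:
  assumes "zero_minima \<Theta> l" "t \<ge> 1" "q \<in> \<Theta>"
  shows "l t q \<ge> 0"
  using assms unfolding zero_minima_def is_arg_min_def by force

lemma zero_minima_arg_min_eq_0:
  assumes "zero_minima \<Theta> l" "t \<ge> 1" "is_arg_min (l t) (\<lambda>q. q \<in> \<Theta>) p"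
  shows "l t p = 0"
  using assms unfolding zero_minima_def is_arg_min_def by (metis linorder_neqE)

lemma no_regret_converges_ip:
  assumes "no_regret \<Theta> E A" "(l, fb) \<in> E"
    and zero: "zero_minima \<Theta> l" and common: "common_minimisers \<Theta> l"
  shows "converges_ip (\<lambda>t. l t (choice A fb t)) 0"
proof -
  obtain \<Delta> where feasible: "\<And>t. t \<ge> 1 \<Longrightarrow> choice A fb t \<in> \<Theta>"
    and smallo: "\<Delta> \<in> o(\<lambda>T. real T)"
    and regret: "\<And>T p. T \<ge> 1 \<Longrightarrow> best_in_hindsight \<Theta> l T p \<Longrightarrow> regret l (choice A fb) p T \<le> \<Delta> T"
    using assms(1,2) unfolding no_regret_def by fast
  have "(\<Sum>t=1..T. l t (choice A fb t)) \<le> \<Delta> T" if "T \<ge> 1" for T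
  proof -
    obtain p where p: "\<And>t. t \<in> {1..T} \<Longrightarrow> is_arg_min (l t) (\<lambda>q. q \<in> \<Theta>) p"
      using common unfolding common_minimisers_def by blast
    \<comment> \<open>A horizon of at least 1 is essential here: over an empty range
      \<open>p\<close> would be arbitrary.\<close>
    have "p \<in> \<Theta>"
      using p[of 1] that by (simp add: is_arg_min_def)
    have total: "(\<Sum>t=1..T. l t p) = 0"
      using zero_minima_arg_min_eq_0[OF zero _ p] by (intro sum.neutral) auto
    have "(\<Sum>t=1..T. l t q) \<ge> 0" if "q \<in> \<Theta>" for q
      using zero_minima_nonneg[OF zero _ that] by (intro sum_nonneg) auto
    \<comment> \<open>Total loss 0 is the least possible, so \<open>p\<close> is an admissible
      comparator, and the regret against it is the whole loss suffered.\<close>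
    then have "best_in_hindsight \<Theta> l T p"
      using \<open>p \<in> \<Theta>\<close> total unfolding best_in_hindsight_def is_arg_min_linorder by simp
    with regret[OF that this] total show ?thesis
      by (simp add: regret_def)
  qed
  then show ?thesis
    using zero_minima_nonneg[OF zero _ feasible] smallo
    by (intro converges_ip_zero_if_sum_le_smallo) auto
qed

text \<open>The parameter that represents the target predicts without error at every input. As the
  losses are nonnegative on \<open>\<Theta>\<close>, this one parameter minimises all of them,
  whatever the horizon.\<close>

lemma realisable_minimisers:
  assumes "f \<in> hypothesis_space \<Theta> fhat" "prediction_loss \<Theta> fhat f L"
    and l: "\<And>t p. t \<ge> 1 \<Longrightarrow> p \<in> \<Theta> \<Longrightarrow> l t p = L (x t) p"
  shows "zero_minima \<Theta> l" "common_minimisers \<Theta> l"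
proof -
  obtain p where p: "p \<in> \<Theta>" "f = (\<lambda>x. fhat x p)"
    using assms(1) by (auto simp: hypothesis_space_def)
  have "is_arg_min (l t) (\<lambda>q. q \<in> \<Theta>) p \<and> l t p = 0" if "t \<ge> 1" for t
    using assms(2) p l[OF that] by (simp add: is_arg_min_linorder prediction_loss_def)
  then show "zero_minima \<Theta> l" "common_minimisers \<Theta> l"
    unfolding zero_minima_def common_minimisers_def by (meson atLeastAtMost_iff)+
qed

theorem theorem3:
  fixes \<Theta> :: "'p set"
    and E :: "('p, 'i) environment set"
    and A :: "('p, 'i) algorithm"
    and l :: "'p losses"
    and fb :: "('p, 'i) feedback"
    and \<F> :: "('x \<Rightarrow> 'y) set"
    and fhat :: "'x \<Rightarrow> 'p \<Rightarrow> 'y"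
    and f :: "'x \<Rightarrow> 'y"
    and L :: "'x \<Rightarrow> 'p \<Rightarrow> real"
    and x :: "nat \<Rightarrow> 'x"
  assumes "no_regret \<Theta> E A"
    and "(l, fb) \<in> E"
  shows "(zero_minima \<Theta> l \<and> common_minimisers \<Theta> l \<longrightarrow>
            converges_ip (\<lambda>t. l t (choice A fb t)) 0) \<and>
         (\<F> \<subseteq> hypothesis_space \<Theta> fhat \<and> f \<in> \<F> \<and> prediction_loss \<Theta> fhat f L \<and>
          (\<forall>t\<ge>1. \<forall>p\<in>\<Theta>. l t p = L (x t) p) \<longrightarrow>
            zero_minima \<Theta> l \<and> converges_ip (\<lambda>t. l t (choice A fb t)) 0)"
proof (intro conjI impI; elim conjE)
  assume "zero_minima \<Theta> l" "common_minimisers \<Theta> l"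
  then show "converges_ip (\<lambda>t. l t (choice A fb t)) 0"
    by (rule no_regret_converges_ip[OF assms])
next
  assume "\<F> \<subseteq> hypothesis_space \<Theta> fhat" "f \<in> \<F>" "prediction_loss \<Theta> fhat f L"
    and "\<forall>t\<ge>1. \<forall>p\<in>\<Theta>. l t p = L (x t) p"
  \<comment> \<open>The inclusion places \<open>f\<close> itself in the hypothesis space, which
    reduces this case to the previous one.\<close>
  then have *: "zero_minima \<Theta> l" "common_minimisers \<Theta> l"
    using realisable_minimisers[of f \<Theta> fhat L l x] by auto
  show "zero_minima \<Theta> l"
    by (rule *)
  show "converges_ip (\<lambda>t. l t (choice A fb t)) 0"
    by (rule no_regret_converges_ip[OF assms *])
qed

end
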